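(* Let $\mathcal{X},\mathcal{Y}$ be finite sets and $\{p(x,y|\theta)\mid\theta\in\Theta\}$ a model on $\mathcal{X}\times\mathcal{Y}$ as in the context, so that $\Theta$ is compact and for every $x\in\mathcal{X}$ there is $\theta\in\Theta$ with $p(x|\theta)>0$. 1) For every predictive density $q(y;x)$, there exists a convergent prior sequence $\{\pi_n\}_{n=1}^\infty$ in $\mathcal{P}$ (with $p_{\pi_n}(x)>0$ for every $n$ and every $x\in\mathcal{X}$) such that the limit $\lim_{n\to\infty}p_{\pi_n}(y|x)$ of Bayesian predictive densities exists and $$R\bigl(\theta,\lim_{n\to\infty}p_{\pi_n}(y|x)\bigr)\le R(\theta,q(y;x))\quad\text{for every }\theta\in\Theta.$$ 2) Let $q(y;x)$ be a predictive density. If there exists $\hat\pi\in\mathcal{P}$ such that $D_q(\hat\pi)=\inf_{\pi\in\mathcal{P}}D_q(\pi)$ and $p_{\hat\pi}(x)>0$ for every $x\in\mathcal{X}$, then $$R(\theta,p_{\hat\pi}(y|x))\le R(\theta,q(y;x))\quad\text{for every }\theta\in\Theta.$$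
   Context: Setting. $\mathcal{X}$ and $\mathcal{Y}$ are finite sets with $k$ and $l$ elements. $\{p(x,y|\theta)\mid\theta\in\Theta\}$ is a set of probability densities (mass functions) on $\mathcal{X}\times\mathcal{Y}$; $\Theta$ is identified with this set, i.e. with a subset of the probability simplex in $\mathbb{R}^{kl}$, and carries the induced Euclidean topology (so $\theta\mapsto p(x,y|\theta)$ is continuous for each $(x,y)$). Write $p(x|\theta)=\sum_{y}p(x,y|\theta)$ and $p(y|x,\theta)=p(x,y|\theta)/p(x|\theta)$ when $p(x|\theta)>0$. Standing assumptions: (1) $\Theta$ is compact; (2) for every $x\in\mathcal{X}$ there exists $\theta\in\Theta$ with $p(x|\theta)>0$. Priors. $\mathcal{P}$ is the set of all (Borel) probability measures on $\Theta$ with the topology of weak convergence; a convergent prior sequence is a sequence converging in $\mathcal{P}$. For $\pi\in\mathcal{P}$, $p_\pi(x,y)=\int p(x,y|\theta)\,d\pi(\theta)$, $p_\pi(x)=\int p(x|\theta)\,d\pi(\theta)$, and $p_\pi(y|x)=p_\pi(x,y)/p_\pi(x)$ when $p_\pi(x)>0$. A predictive density is a function $q(y;x)$ from $\mathcal{X}\times\mathcal{Y}$ to $[0,1]$ with $\sum_{y\in\mathcal{Y}}q(y;x)=1$ for every $x\in\mathcal{X}$. Risk: $R(\theta,q)=\sum_{x,y}p(x,y|\theta)\log\dfrac{p(y|x,\theta)}{q(y;x)}\in[0,\infty]$, with the conventions $c\log 0=-\infty$ for $c>0$, $0\log 0=0$, $0\log(c/0)=0$ for $c\ge 0$; terms with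 $p(x,y|\theta)=0$ are $0$ (so the value does not depend on the choice of $p(y|x,\theta)$ when $p(x|\theta)=0$), and a term with $p(x,y|\theta)>0$, $q(y;x)=0$ equals $+\infty$. For a predictive density $q$, $D_q:\mathcal{P}\to[0,\infty]$ is $$D_q(\pi)=\sum_{x,y}p_\pi(x,y)\log\frac{p_\pi(x,y)}{q(y;x)\,p_\pi(x)}=\sum_{x,y}p_\pi(x,y)\log p_\pi(x,y)-\sum_x p_\pi(x)\log p_\pi(x)-\sum_{x,y}p_\pi(x,y)\log q(y;x),$$ with the same conventions. Limits of Bayesian predictive densities: for a sequence of priors $\{\pi_n\}$ with $p_{\pi_n}(x)>0$ for every $n$ and every $x\in\mathcal{X}$, $\lim_{n\to\infty}p_{\pi_n}(y|x)$ denotes the map sending $(x,y)$ to the limit of the real sequence $\{p_{\pi_n}(y|x)\}_{n}$; it is said to exist if these limits exist for all $(x,y)\in\mathcal{X}\times\mathcal{Y}$, and it is then a predictive density. *)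

theory Defs
  imports "HOL-Probability.Probability"
begin

text \<open>
  A probability mass function on the product of two finite types is a point of the probability
  simplex in Euclidean space. A model is a set \<open>\<Theta>\<close> of such points: the parameter \<open>\<theta>\<close> is identified
  with its mass function, so \<open>p(x,y|\<theta>)\<close> is \<open>\<theta> $ (x, y)\<close>, and \<open>\<Theta>\<close> carries the Euclidean subspace
  topology.
\<close>

definition prob_simplex :: "(real ^ ('x::finite \<times> 'y::finite)) set" where
  "prob_simplex = {\<theta>. (\<forall>i. 0 \<le> \<theta> $ i) \<and> (\<Sum>i\<in>UNIV. \<theta> $ i) = 1}"

definition marginal :: "real ^ ('x::finite \<times> 'y::finite) \<Rightarrow> 'x \<Rightarrow> real" where
  "marginal \<theta> x = (\<Sum>y\<in>UNIV. \<theta> $ (x, y))"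

text \<open>As \<open>r / 0 = 0\<close>, the following is \<open>0\<close> when the marginal vanishes; this value is never used.\<close>

definition cond_density :: "real ^ ('x::finite \<times> 'y::finite) \<Rightarrow> 'x \<Rightarrow> 'y \<Rightarrow> real" where
  "cond_density \<theta> x y = \<theta> $ (x, y) / marginal \<theta> x"

definition priors ::
  "(real ^ ('x::finite \<times> 'y::finite)) set \<Rightarrow> (real ^ ('x \<times> 'y)) measure set" where
  "priors \<Theta> = {\<pi>. prob_space \<pi> \<and> sets \<pi> = sets (restrict_space borel \<Theta>)}"

definition weakly_converges ::
  "'a::topological_space set \<Rightarrow> (nat \<Rightarrow> 'a measure) \<Rightarrow> 'a measure \<Rightarrow> bool" where
  "weakly_converges \<Theta> \<pi>s \<pi> \<longleftrightarrow>
     (\<forall>f :: 'a \<Rightarrow> real. continuous_on \<Theta> f \<and> bounded (f ` \<Theta>) \<longrightarrow>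
        (\<lambda>n. \<integral>\<theta>. f \<theta> \<partial>\<pi>s n) \<longlonglongrightarrow> (\<integral>\<theta>. f \<theta> \<partial>\<pi>))"

definition convergent_prior_seq ::
  "(real ^ ('x::finite \<times> 'y::finite)) set \<Rightarrow> (nat \<Rightarrow> (real ^ ('x \<times> 'y)) measure) \<Rightarrow> bool" where
  "convergent_prior_seq \<Theta> \<pi>s \<longleftrightarrow>
     (\<forall>n. \<pi>s n \<in> priors \<Theta>) \<and> (\<exists>\<pi>\<in>priors \<Theta>. weakly_converges \<Theta> \<pi>s \<pi>)"

definition mix_joint ::
  "(real ^ ('x::finite \<times> 'y::finite)) measure \<Rightarrow> 'x \<Rightarrow> 'y \<Rightarrow> real" where
  "mix_joint \<pi> x y = (\<integral>\<theta>. \<theta> $ (x, y) \<partial>\<pi>)"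

definition mix_marginal ::
  "(real ^ ('x::finite \<times> 'y::finite)) measure \<Rightarrow> 'x \<Rightarrow> real" where
  "mix_marginal \<pi> x = (\<integral>\<theta>. marginal \<theta> x \<partial>\<pi>)"

definition bayes_pred ::
  "(real ^ ('x::finite \<times> 'y::finite)) measure \<Rightarrow> 'x \<Rightarrow> 'y \<Rightarrow> real" where
  "bayes_pred \<pi> x y = mix_joint \<pi> x y / mix_marginal \<pi> x"

text \<open>Predictive densities \<open>q(y;x)\<close> are written \<open>q x y\<close>.\<close>

definition predictive_density :: "('x::finite \<Rightarrow> 'y::finite \<Rightarrow> real) \<Rightarrow> bool" where
  "predictive_density q \<longleftrightarrow>
     (\<forall>x y. 0 \<le> q x y \<and> q x y \<le> 1) \<and> (\<forall>x. (\<Sum>y\<in>UNIV. q x y) = 1)"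

text \<open>
  For \<open>r \<ge> 0\<close>, \<open>elog r\<close> is the natural logarithm with \<open>log 0 = -\<infinity>\<close>. The term \<open>c log (a / b)\<close> is
  \<open>log_ratio_term c a b\<close>. Since \<open>0 * \<plusminus>\<infinity> = 0\<close> in \<^typ>\<open>ereal\<close>, it is \<open>0\<close> for \<open>c = 0\<close>, and it is \<open>\<infinity>\<close> for
  \<open>c > 0\<close>, \<open>a > 0\<close>, \<open>b = 0\<close>. Below, \<open>c > 0\<close> always entails \<open>a > 0\<close>, so the sums never contain \<open>-\<infinity>\<close>.
\<close>

definition elog :: "real \<Rightarrow> ereal" where
  "elog r = (if r = 0 then -\<infinity> else ereal (ln r))"

definition log_ratio_term :: "real \<Rightarrow> real \<Rightarrow> real \<Rightarrow> ereal" where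
  "log_ratio_term c a b = ereal c * (elog a - elog b)"

definition risk ::
  "real ^ ('x::finite \<times> 'y::finite) \<Rightarrow> ('x \<Rightarrow> 'y \<Rightarrow> real) \<Rightarrow> ereal" where
  "risk \<theta> q =
     (\<Sum>x\<in>UNIV. \<Sum>y\<in>UNIV. log_ratio_term (\<theta> $ (x, y)) (cond_density \<theta> x y) (q x y))"

definition D ::
  "('x::finite \<Rightarrow> 'y::finite \<Rightarrow> real) \<Rightarrow> (real ^ ('x \<times> 'y)) measure \<Rightarrow> ereal" where
  "D q \<pi> =
     (\<Sum>x\<in>UNIV. \<Sum>y\<in>UNIV.
        log_ratio_term (mix_joint \<pi> x y) (mix_joint \<pi> x y) (q x y * mix_marginal \<pi> x))"

end

theory Submission
  imports Defs "HOL-Real_Asymp.Real_Asymp"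
begin

text \<open>
  Apart from weak convergence, the theorem sees a prior \<open>\<pi>\<close> only through its barycenter
  \<open>m = \<integral>\<theta> d\<pi>\<close>: the Bayesian predictive density is the conditional density of \<open>m\<close>, and \<open>D\<^sub>q(\<pi>)\<close> is
  the risk of \<open>q\<close> at \<open>m\<close>. The barycenters of the priors form exactly the convex hull of \<open>\<Theta>\<close>, which
  is compact. So the theorem is about minimising the conditional relative entropy
  \<open>m \<mapsto> \<Sum>\<^sub>x\<^sub>,\<^sub>y m(x,y) log (m(y|x) / q(y;x))\<close> over a convex set.

  The heart is \<open>minimiser_dominates\<close>. Let \<open>m\<close> be a minimiser, \<open>\<theta>\<close> another point and
  \<open>m\<^sub>t = (1 - t) m + t \<theta>\<close>. The entropy of \<open>m\<^sub>t\<close> is the combination, with weights \<open>1 - t\<close> and \<open>t\<close>,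
  of the sums of \<open>log (m\<^sub>t(y|x) / q(y;x))\<close> weighted by \<open>m\<close> and by \<open>\<theta>\<close>; by the Gibbs inequality the sum
  weighted by \<open>m\<close> is at most the entropy of \<open>m\<close>. Minimality therefore forces \<open>\<Sum> \<theta> log (m\<^sub>t(y|x) / q(y;x))\<close> to be at least the entropy of
  \<open>m\<close>, which is nonnegative, and \<open>t \<rightarrow> 0\<close> gives the same bound with \<open>m\<close> in place of \<open>m\<^sub>t\<close>. That sum is the
  risk of \<open>q\<close> minus the risk of \<open>m(y|x)\<close>, which is the second part of the theorem. No
  derivative is taken, but the limit needs \<open>m(x) > 0\<close> wherever \<open>\<theta>(x) > 0\<close>.

  A minimiser may have \<open>m(x) = 0\<close> for some \<open>x\<close>, and the entropy may be infinite on much of the hull.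
  For the first part both defects are removed by a perturbation of size \<open>s\<close>: \<open>q\<close> is mixed with the
  uniform density, and the hull is shrunk towards a point \<open>\<mu>\<close> with positive marginals. The
  minimiser of the perturbed problem then dominates up to an error
  \<open>s / (1 - s) * log (|Y| / s)\<close> (\<open>approximate_dominator\<close>), which tends to \<open>0\<close> with \<open>s\<close>. A
  subsequence along which the conditional densities converge dominates in the limit, because
  log-likelihoods are upper semicontinuous (\<open>log_lik_limit\<close>). By Caratheodory's theorem the
  minimisers are barycenters of priors on a bounded number of atoms; weights and atoms range over
  compact sets, so a further subsequence of these priors converges weakly.
\<close>

section \<open>Log-likelihoods and conditional densities\<close>

definition log_lik :: "real ^ ('x::finite \<times> 'y::finite) \<Rightarrow> ('x \<Rightarrow> 'y \<Rightarrow> real) \<Rightarrow> real" where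
  "log_lik \<theta> r = (\<Sum>x\<in>UNIV. \<Sum>y\<in>UNIV. \<theta> $ (x, y) * ln (r x y))"

text \<open>
  This is the real-valued form of the functional \<open>D\<^sub>q\<close> at a prior with barycenter \<open>m\<close>. Since \<open>ln 0 = 0\<close>,
  it agrees with \<open>D\<^sub>q\<close> only if \<open>q\<close> is positive on the support of \<open>m\<close>; where \<open>q\<close> vanishes on that
  support, \<open>D\<^sub>q\<close> is infinite and this value is meaningless.
\<close>

definition rel_entropy :: "('x::finite \<Rightarrow> 'y::finite \<Rightarrow> real) \<Rightarrow> real ^ ('x \<times> 'y) \<Rightarrow> real" where
  "rel_entropy q m = log_lik m (cond_density m) - log_lik m q"

lemma prob_simplex_nonneg: "\<theta> \<in> prob_simplex \<Longrightarrow> 0 \<le> \<theta> $ i"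
  by (cases i) (simp add: prob_simplex_def)

lemma sum_marginal: "(\<Sum>x\<in>UNIV. marginal \<theta> x) = (\<Sum>i\<in>UNIV. \<theta> $ i)"
  by (simp add: marginal_def sum.cartesian_product)

lemma le_marginal:
  assumes "\<And>i. 0 \<le> \<theta> $ i"
  shows "\<theta> $ (x, y) \<le> marginal \<theta> x"
  unfolding marginal_def using member_le_sum[of y UNIV "\<lambda>y. \<theta> $ (x, y)"] assms by auto

lemma marginal_nonneg: "(\<And>i. 0 \<le> \<theta> $ i) \<Longrightarrow> 0 \<le> marginal \<theta> x"
  by (simp add: marginal_def sum_nonneg)

lemma marginal_add: "marginal (\<theta> + \<theta>') x = marginal \<theta> x + marginal \<theta>' x"
  by (simp add: marginal_def sum.distrib)

lemma marginal_scaleR: "marginal (c *\<^sub>R \<theta>) x = c * marginal \<theta> x"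
  by (simp add: marginal_def sum_distrib_left)

lemma marginal_sum: "marginal (\<Sum>i\<in>I. \<theta> i) x = (\<Sum>i\<in>I. marginal (\<theta> i) x)"
  by (simp add: marginal_def sum.swap[of _ I])

lemma log_lik_add: "log_lik (\<theta> + \<theta>') r = log_lik \<theta> r + log_lik \<theta>' r"
  by (simp add: log_lik_def sum.distrib algebra_simps)

lemma log_lik_scaleR: "log_lik (c *\<^sub>R \<theta>) r = c * log_lik \<theta> r"
  by (simp add: log_lik_def sum_distrib_left algebra_simps)

lemma cond_density_nonneg: "(\<And>i. 0 \<le> \<theta> $ i) \<Longrightarrow> 0 \<le> cond_density \<theta> x y"
  by (simp add: cond_density_def marginal_nonneg)

lemma cond_density_le_1: "(\<And>i. 0 \<le> \<theta> $ i) \<Longrightarrow> cond_density \<theta> x y \<le> 1"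
  using le_marginal[of \<theta> x y] marginal_nonneg[of \<theta> x]
  by (auto simp: cond_density_def divide_le_eq_1)

lemma cond_density_pos:
  assumes "\<And>i. 0 \<le> \<theta> $ i" "0 < \<theta> $ (x, y)"
  shows "0 < cond_density \<theta> x y"
  using le_marginal[OF assms(1), of x y] assms(2) by (simp add: cond_density_def)

lemma sum_cond_density_le_1: "(\<Sum>y\<in>UNIV. cond_density \<theta> x y) \<le> 1"
  by (simp add: cond_density_def sum_divide_distrib[symmetric] marginal_def[symmetric])

lemma tendsto_marginal:
  "(m \<longlongrightarrow> m0) F \<Longrightarrow> ((\<lambda>n. marginal (m n) x) \<longlongrightarrow> marginal m0 x) F"
  unfolding marginal_def by (intro tendsto_sum tendsto_vec_nth)

lemma tendsto_cond_density:
  assumes "(m \<longlongrightarrow> m0) F" "marginal m0 x \<noteq> 0"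
  shows "((\<lambda>n. cond_density (m n) x y) \<longlongrightarrow> cond_density m0 x y) F"
  unfolding cond_density_def using assms
  by (intro tendsto_divide tendsto_vec_nth tendsto_marginal)

text \<open>
  Termwise, \<open>ln u \<le> u - 1\<close> at \<open>u = r(y;x) / m(y|x)\<close>; the bounds add up to at most \<open>0\<close>. The
  values \<open>r(\<cdot>;x)\<close> may be a subdensity: a conditional density is identically zero at an \<open>x\<close> without mass.
\<close>

lemma gibbs_inequality:
  assumes m: "\<And>i. 0 \<le> m $ i"
    and r: "\<And>x y. 0 \<le> r x y" "\<And>x. (\<Sum>y\<in>UNIV. r x y) \<le> 1"
    and supp: "\<And>x y. 0 < m $ (x, y) \<Longrightarrow> 0 < r x y"
  shows "log_lik m r \<le> log_lik m (cond_density m)"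
proof -
  have *: "m $ (x, y) * ln (r x y) - m $ (x, y) * ln (cond_density m x y)
      \<le> marginal m x * r x y - m $ (x, y)" for x y
  proof (cases "m $ (x, y) = 0")
    case True
    then show ?thesis using marginal_nonneg[OF m, of x] r(1)[of x y] by simp
  next
    case False
    then have p: "0 < m $ (x, y)" using m[of "(x, y)"] by simp
    then have q: "0 < r x y" "0 < cond_density m x y" "0 < marginal m x"
      using supp cond_density_pos[OF m] le_marginal[OF m, of x y] by auto
    have "ln (r x y) - ln (cond_density m x y) = ln (r x y / cond_density m x y)"
      using q by (simp add: ln_div)
    also have "\<dots> \<le> r x y / cond_density m x y - 1"
      using q by (intro ln_le_minus_one) simp
    finally have "m $ (x, y) * (ln (r x y) - ln (cond_density m x y))
        \<le> m $ (x, y) * (r x y / cond_density m x y - 1)"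
      using p by (intro mult_left_mono) auto
    also have "\<dots> = marginal m x * r x y - m $ (x, y)"
      using p q by (simp add: cond_density_def field_simps)
    finally show ?thesis by (simp add: algebra_simps)
  qed
  have "log_lik m r - log_lik m (cond_density m) =
      (\<Sum>x\<in>UNIV. \<Sum>y\<in>UNIV. m $ (x, y) * ln (r x y) - m $ (x, y) * ln (cond_density m x y))"
    by (simp add: log_lik_def sum_subtractf)
  also have "\<dots> \<le> (\<Sum>x\<in>UNIV. \<Sum>y\<in>UNIV. marginal m x * r x y - m $ (x, y))"
    by (intro sum_mono *)
  also have "\<dots> = (\<Sum>x\<in>UNIV. marginal m x * (\<Sum>y\<in>UNIV. r x y) - marginal m x)"
    by (simp add: sum_subtractf sum_distrib_left marginal_def)
  also have "\<dots> \<le> 0"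
  proof (rule sum_nonpos)
    fix x
    show "marginal m x * (\<Sum>y\<in>UNIV. r x y) - marginal m x \<le> 0"
      using mult_left_mono[OF r(2)[of x] marginal_nonneg[OF m, of x]] by simp
  qed
  finally show ?thesis by simp
qed

text \<open>
  Upper semicontinuity of the log-likelihood, including the case that \<open>r n x y\<close> tends to \<open>0\<close> where
  \<open>\<theta>\<close> has mass. Exponentiating turns the sum into the likelihood \<open>\<Prod> r(y;x)\<^bsup>\<theta>(x,y)\<^esup>\<close>, which is continuous
  up to the boundary; the lower bound keeps it away from \<open>0\<close>, so that no factor vanishes in the limit.
\<close>

lemma log_lik_limit:
  assumes \<theta>: "\<And>i. 0 \<le> \<theta> $ i"
    and lim: "\<And>x y. 0 < \<theta> $ (x, y) \<Longrightarrow> (\<lambda>n. r n x y) \<longlonglongrightarrow> r0 x y"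
    and pos: "\<And>n x y. 0 < \<theta> $ (x, y) \<Longrightarrow> 0 < r n x y"
    and le: "\<And>n. c n \<le> log_lik \<theta> (r n)" and c: "c \<longlonglongrightarrow> c0"
  shows "(\<forall>x y. 0 < \<theta> $ (x, y) \<longrightarrow> 0 < r0 x y) \<and> c0 \<le> log_lik \<theta> r0"
proof -
  \<comment> \<open>Factors with exponent \<open>0\<close> are left out, as \<open>0 powr 0 = 0\<close>.\<close>
  define lik where
    "lik r = (\<Prod>x\<in>UNIV. \<Prod>y\<in>UNIV. if 0 < \<theta> $ (x, y) then r x y powr \<theta> $ (x, y) else 1)"
    for r :: "'a \<Rightarrow> 'b \<Rightarrow> real"
  have exp: "exp (log_lik \<theta> r) = lik r" if "\<And>x y. 0 < \<theta> $ (x, y) \<Longrightarrow> 0 < r x y" for r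
    unfolding log_lik_def lik_def exp_sum[OF finite]
  proof (intro prod.cong refl)
    fix x y
    show "exp (\<theta> $ (x, y) * ln (r x y)) =
        (if 0 < \<theta> $ (x, y) then r x y powr \<theta> $ (x, y) else 1)"
      using that[of x y] \<theta>[of "(x, y)"] by (cases "\<theta> $ (x, y) = 0") (auto simp: powr_def)
  qed
  have "(\<lambda>n. lik (r n)) \<longlonglongrightarrow> lik r0"
    unfolding lik_def
  proof (intro tendsto_prod)
    fix x y
    show "(\<lambda>n. if 0 < \<theta> $ (x, y) then r n x y powr \<theta> $ (x, y) else 1)
        \<longlonglongrightarrow> (if 0 < \<theta> $ (x, y) then r0 x y powr \<theta> $ (x, y) else 1)"
      using lim[of x y] pos[of x y]
      by (auto intro!: tendsto_powr' always_eventually less_imp_le)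
  qed
  moreover have "(\<lambda>n. exp (c n)) \<longlonglongrightarrow> exp c0"
    using c by (rule tendsto_exp)
  moreover have "exp (c n) \<le> lik (r n)" for n
    using le[of n] exp[of "r n"] pos[of _ _ n] by (metis exp_le_cancel_iff)
  ultimately have *: "exp c0 \<le> lik r0"
    by (meson LIMSEQ_le)
  have r0: "0 < r0 x y" if p: "0 < \<theta> $ (x, y)" for x y
  proof -
    have "0 \<le> r0 x y"
      using lim[OF p] pos[OF p] by (meson LIMSEQ_le_const less_imp_le)
    moreover have "lik r0 \<noteq> 0" using * exp_gt_zero[of c0] by linarith
    then have "r0 x y \<noteq> 0"
      unfolding lik_def using p by (auto dest!: spec split: if_splits)
    ultimately show ?thesis by simp
  qed
  have "exp c0 \<le> exp (log_lik \<theta> r0)" using * exp[OF r0] by simp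
  with r0 show ?thesis by simp
qed

section \<open>Minimisers of the relative entropy\<close>

text \<open>
  Only the comparison of \<open>m\<close> with the points of the segment towards \<open>\<theta>\<close> matters. The entropy at
  a point of the segment is bounded through the Gibbs inequality for \<open>m\<close>, which leaves a lower bound
  for the log-likelihood at \<open>\<theta>\<close> that survives the passage to the endpoint \<open>m\<close>. The hypothesis on
  the marginals makes the conditional densities converge there.
\<close>

lemma minimiser_dominates:
  assumes m: "\<And>i. 0 \<le> m $ i" and \<theta>: "\<And>i. 0 \<le> \<theta> $ i"
    and marg: "\<And>x. 0 < marginal \<theta> x \<Longrightarrow> 0 < marginal m x"
    and min: "\<And>t. 0 < t \<Longrightarrow> t < 1 \<Longrightarrow> rel_entropy q m \<le> rel_entropy q ((1 - t) *\<^sub>R m + t *\<^sub>R \<theta>)"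
  shows "(\<forall>x y. 0 < \<theta> $ (x, y) \<longrightarrow> 0 < cond_density m x y) \<and>
    log_lik \<theta> q + rel_entropy q m \<le> log_lik \<theta> (cond_density m)"
proof -
  define t :: "nat \<Rightarrow> real" where "t n = 1 / (real n + 2)" for n
  define seg where "seg n = (1 - t n) *\<^sub>R m + t n *\<^sub>R \<theta>" for n
  have t: "0 < t n" "t n < 1" for n by (auto simp: t_def)
  have seg_nonneg: "0 \<le> seg n $ i" for n i
    using t[of n] m[of i] \<theta>[of i] by (simp add: seg_def)
  have seg_pos: "0 < seg n $ i" if "0 < m $ i \<or> 0 < \<theta> $ i" for n i
    using that t[of n] m[of i] \<theta>[of i]
    by (auto simp: seg_def intro: add_pos_nonneg add_nonneg_pos)
  have "t \<longlonglongrightarrow> 0" unfolding t_def by real_asymp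
  then have "seg \<longlonglongrightarrow> (1 - 0) *\<^sub>R m + 0 *\<^sub>R \<theta>"
    unfolding seg_def by (intro tendsto_intros)
  then have seg_lim: "seg \<longlonglongrightarrow> m" by simp
  have seg_lik: "log_lik (seg n) r = (1 - t n) * log_lik m r + t n * log_lik \<theta> r" for n r
    by (simp only: seg_def log_lik_add log_lik_scaleR)
  have le: "log_lik \<theta> q + rel_entropy q m \<le> log_lik \<theta> (cond_density (seg n))" for n
  proof -
    have g: "log_lik m (cond_density (seg n)) \<le> log_lik m (cond_density m)"
      by (intro gibbs_inequality m cond_density_nonneg seg_nonneg sum_cond_density_le_1
            cond_density_pos seg_pos disjI1)
    have "rel_entropy q m \<le> rel_entropy q (seg n)"
      unfolding seg_def using min t by blast
    also have "\<dots> = (1 - t n) * (log_lik m (cond_density (seg n)) - log_lik m q)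
        + t n * (log_lik \<theta> (cond_density (seg n)) - log_lik \<theta> q)"
      unfolding rel_entropy_def seg_lik by (simp add: algebra_simps)
    also have "\<dots> \<le> (1 - t n) * rel_entropy q m
        + t n * (log_lik \<theta> (cond_density (seg n)) - log_lik \<theta> q)"
      using g t[of n] by (intro add_right_mono mult_left_mono) (auto simp: rel_entropy_def)
    finally have "t n * rel_entropy q m
        \<le> t n * (log_lik \<theta> (cond_density (seg n)) - log_lik \<theta> q)"
      by (simp add: algebra_simps)
    then show ?thesis using t(1)[of n] by simp
  qed
  show ?thesis
  proof (rule log_lik_limit[OF \<theta> _ _ le tendsto_const])
    fix x y n assume p: "0 < \<theta> $ (x, y)"
    then have "0 < marginal \<theta> x" using le_marginal[OF \<theta>, of x y] by linarith
    then have "marginal m x \<noteq> 0" using marg by force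
    with seg_lim show "(\<lambda>n. cond_density (seg n) x y) \<longlonglongrightarrow> cond_density m x y"
      by (rule tendsto_cond_density)
    show "0 < cond_density (seg n) x y"
      using p by (intro cond_density_pos seg_nonneg seg_pos disjI2)
  qed
qed

lemma continuous_on_mult_ln: "continuous_on {0..} (\<lambda>x::real. x * ln x)"
  unfolding continuous_on_def
proof
  fix a :: real assume "a \<in> {0..}"
  show "((\<lambda>x. x * ln x) \<longlongrightarrow> a * ln a) (at a within {0..})"
  proof (cases "a = 0")
    case True
    have "((\<lambda>x::real. x * ln x) \<longlongrightarrow> 0) (at_right 0)" by real_asymp
    with True show ?thesis by (simp add: at_within_Ici_at_right)
  next
    case False
    then show ?thesis by (intro tendsto_intros) auto
  qed
qed

text \<open>
  Written as \<open>\<Sum> m(x,y) ln m(x,y) - \<Sum> m(x) ln m(x) - \<Sum> m(x,y) ln q(y;x)\<close>, the entropy is continuous also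
  where marginals vanish, although conditional densities jump there.
\<close>

lemma continuous_on_rel_entropy: "continuous_on {m. \<forall>i. 0 \<le> m $ i} (rel_entropy q)"
proof -
  let ?S = "{m :: real ^ ('a \<times> 'b). \<forall>i. 0 \<le> m $ i}"
  have "continuous_on ?S (\<lambda>m. (\<Sum>x\<in>UNIV. (\<Sum>y\<in>UNIV. m $ (x, y) * ln (m $ (x, y)))
      - marginal m x * ln (marginal m x)) - log_lik m q)"
    unfolding log_lik_def
  proof (intro continuous_on_diff continuous_on_sum)
    show "continuous_on ?S (\<lambda>m. m $ (x, y) * ln (m $ (x, y)))" for x y
      by (rule continuous_on_compose2[OF continuous_on_mult_ln]) (auto intro!: continuous_intros)
    show "continuous_on ?S (\<lambda>m. marginal m x * ln (marginal m x))" for x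
      by (rule continuous_on_compose2[OF continuous_on_mult_ln])
        (auto intro!: marginal_nonneg continuous_intros simp: marginal_def[abs_def] sum_nonneg)
  qed (intro continuous_intros)
  moreover have "rel_entropy q m = (\<Sum>x\<in>UNIV. (\<Sum>y\<in>UNIV. m $ (x, y) * ln (m $ (x, y)))
      - marginal m x * ln (marginal m x)) - log_lik m q" if "m \<in> ?S" for m
  proof -
    have m: "\<And>i. 0 \<le> m $ i" using that by blast
    have *: "m $ (x, y) * ln (cond_density m x y) =
        m $ (x, y) * ln (m $ (x, y)) - m $ (x, y) * ln (marginal m x)" for x y
      using m[of "(x, y)"] le_marginal[OF m, of x y]
      by (cases "m $ (x, y) = 0") (auto simp: cond_density_def ln_div algebra_simps)
    have "log_lik m (cond_density m) = (\<Sum>x\<in>UNIV. (\<Sum>y\<in>UNIV. m $ (x, y) * ln (m $ (x, y)))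
      - (\<Sum>y\<in>UNIV. m $ (x, y)) * ln (marginal m x))"
      unfolding log_lik_def * by (simp add: sum_subtractf sum_distrib_right)
    then show ?thesis by (simp add: rel_entropy_def marginal_def)
  qed
  ultimately show ?thesis by (subst continuous_on_cong[OF refl]) auto
qed

lemma rel_entropy_nonneg:
  assumes "\<And>i. 0 \<le> m $ i" "predictive_density q" "\<And>x y. 0 < m $ (x, y) \<Longrightarrow> 0 < q x y"
  shows "0 \<le> rel_entropy q m"
  using gibbs_inequality[of m q] assms by (simp add: rel_entropy_def predictive_density_def)

section \<open>The risk\<close>

text \<open>
  This separates the two ways in which a risk comparison can hold: the extended-real risk is infinite
  exactly when \<open>r\<close> vanishes somewhere on the support of \<open>\<theta>\<close>, and otherwise it is a difference of real
  log-likelihoods, of which only the second depends on \<open>r\<close>.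
\<close>

lemma risk_eq:
  assumes \<theta>: "\<And>i. 0 \<le> \<theta> $ i" and r: "\<And>x y. 0 \<le> r x y"
  shows "risk \<theta> r = (if \<forall>x y. 0 < \<theta> $ (x, y) \<longrightarrow> 0 < r x y
    then ereal (log_lik \<theta> (cond_density \<theta>) - log_lik \<theta> r) else \<infinity>)"
proof -
  have fin: "log_ratio_term (\<theta> $ (x, y)) (cond_density \<theta> x y) (r x y) =
      ereal (\<theta> $ (x, y) * ln (cond_density \<theta> x y) - \<theta> $ (x, y) * ln (r x y))"
    if "0 < \<theta> $ (x, y) \<longrightarrow> 0 < r x y" for x y
    using that \<theta>[of "(x, y)"] cond_density_pos[OF \<theta>, of x y]
    by (cases "\<theta> $ (x, y) = 0") (auto simp: log_ratio_term_def elog_def algebra_simps)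
  have inf: "log_ratio_term (\<theta> $ (x, y)) (cond_density \<theta> x y) (r x y) = \<infinity>"
    if "0 < \<theta> $ (x, y)" "\<not> 0 < r x y" for x y
    using that cond_density_pos[OF \<theta>, of x y] r[of x y]
    by (auto simp: log_ratio_term_def elog_def not_less)
  show ?thesis
  proof (cases "\<forall>x y. 0 < \<theta> $ (x, y) \<longrightarrow> 0 < r x y")
    case True
    then have "risk \<theta> r = (\<Sum>x\<in>UNIV. \<Sum>y\<in>UNIV.
        ereal (\<theta> $ (x, y) * ln (cond_density \<theta> x y) - \<theta> $ (x, y) * ln (r x y)))"
      unfolding risk_def using fin by simp
    with True show ?thesis by (simp add: log_lik_def sum_subtractf)
  next
    case False
    then show ?thesis unfolding risk_def using inf by (auto simp: sum_Pinfty)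
  qed
qed

lemma risk_mono:
  assumes \<theta>: "\<And>i. 0 \<le> \<theta> $ i" and nn: "\<And>x y. 0 \<le> r x y" "\<And>x y. 0 \<le> q x y"
    and dom: "(\<And>x y. 0 < \<theta> $ (x, y) \<Longrightarrow> 0 < q x y) \<Longrightarrow>
      (\<forall>x y. 0 < \<theta> $ (x, y) \<longrightarrow> 0 < r x y) \<and> log_lik \<theta> q \<le> log_lik \<theta> r"
  shows "risk \<theta> r \<le> risk \<theta> q"
  using dom by (auto simp: risk_eq[OF \<theta> nn(1)] risk_eq[OF \<theta> nn(2)])

section \<open>Barycenters of priors\<close>

definition barycenter :: "(real ^ 'i::finite) measure \<Rightarrow> real ^ 'i" where
  "barycenter \<pi> = (\<chi> i. \<integral>\<theta>. \<theta> $ i \<partial>\<pi>)"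

lemma borel_measurable_prior:
  assumes "\<pi> \<in> priors \<Theta>" "continuous_on \<Theta> f"
  shows "f \<in> borel_measurable \<pi>"
proof -
  have "f \<in> borel_measurable (restrict_space borel \<Theta>)"
    using assms(2) by (rule borel_measurable_continuous_on_restrict)
  then show ?thesis
    using assms(1) by (subst measurable_cong_sets[of _ "restrict_space borel \<Theta>"]) (auto simp: priors_def)
qed

lemma space_prior: "\<pi> \<in> priors \<Theta> \<Longrightarrow> space \<pi> = \<Theta>"
  using sets_eq_imp_space_eq[of \<pi> "restrict_space borel \<Theta>"] by (auto simp: priors_def space_restrict_space)

lemma integrable_prior:
  fixes f :: "real ^ ('x::finite \<times> 'y::finite) \<Rightarrow> real"
  assumes \<pi>: "\<pi> \<in> priors \<Theta>" and "compact \<Theta>" and f: "continuous_on \<Theta> f"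
  shows "integrable \<pi> f"
proof -
  interpret prob_space \<pi> using \<pi> by (simp add: priors_def)
  have "bounded (f ` \<Theta>)"
    using assms(2) f by (simp add: compact_continuous_image compact_imp_bounded)
  then obtain B where "\<And>\<theta>. \<theta> \<in> \<Theta> \<Longrightarrow> norm (f \<theta>) \<le> B"
    by (auto simp: bounded_iff)
  then show ?thesis
    using borel_measurable_prior[OF \<pi> f] space_prior[OF \<pi>]
    by (intro integrable_const_bound[where B = B]) auto
qed

text \<open>
  A hyperplane separating the barycenter from the closed convex hull would contradict the
  monotonicity of the integral of a linear functional.
\<close>

lemma barycenter_in_convex_hull:
  assumes \<pi>: "\<pi> \<in> priors \<Theta>" and "compact \<Theta>"
  shows "barycenter \<pi> \<in> convex hull \<Theta>"
proof (rule ccontr)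
  interpret prob_space \<pi> using \<pi> by (simp add: priors_def)
  assume "barycenter \<pi> \<notin> convex hull \<Theta>"
  then obtain a b where ab: "inner a (barycenter \<pi>) < b" "\<And>\<theta>. \<theta> \<in> \<Theta> \<Longrightarrow> b < inner a \<theta>"
    using separating_hyperplane_closed_point[OF convex_convex_hull, of \<Theta> "barycenter \<pi>"]
      compact_imp_closed[OF compact_convex_hull[OF assms(2)]] hull_subset[of \<Theta> convex]
    by (metis subsetD)
  have int: "integrable \<pi> (\<lambda>\<theta>. \<theta> $ i)" for i
    by (rule integrable_prior[OF assms]) (intro continuous_intros)
  have "b = (\<integral>\<theta>. b \<partial>\<pi>)" by (simp add: prob_space)
  also have "\<dots> \<le> (\<integral>\<theta>. inner a \<theta> \<partial>\<pi>)"
  proof (intro integral_mono integrable_prior[OF assms])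
    show "continuous_on \<Theta> (inner a)" by (intro continuous_intros)
    show "b \<le> inner a \<theta>" if "\<theta> \<in> space \<pi>" for \<theta>
      using ab(2)[of \<theta>] that space_prior[OF \<pi>] by simp
  qed auto
  also have "\<dots> = (\<Sum>i\<in>UNIV. a $ i * (\<integral>\<theta>. \<theta> $ i \<partial>\<pi>))"
    by (simp add: inner_vec_def int)
  also have "\<dots> = inner a (barycenter \<pi>)"
    by (simp add: inner_vec_def barycenter_def)
  finally show False using ab(1) by simp
qed

lemma mix_joint_barycenter: "mix_joint \<pi> x y = barycenter \<pi> $ (x, y)"
  by (simp add: mix_joint_def barycenter_def)

lemma mix_marginal_barycenter:
  assumes "\<pi> \<in> priors \<Theta>" "compact \<Theta>"
  shows "mix_marginal \<pi> x = marginal (barycenter \<pi>) x"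
proof -
  have int: "integrable \<pi> (\<lambda>\<theta>. \<theta> $ i)" for i
    by (rule integrable_prior[OF assms]) (intro continuous_intros)
  then show ?thesis by (simp add: mix_marginal_def marginal_def barycenter_def)
qed

lemma bayes_pred_barycenter:
  "\<pi> \<in> priors \<Theta> \<Longrightarrow> compact \<Theta> \<Longrightarrow> bayes_pred \<pi> = cond_density (barycenter \<pi>)"
  by (intro ext) (simp add: bayes_pred_def cond_density_def mix_joint_barycenter mix_marginal_barycenter)

text \<open>
  The factor \<open>m(x)\<close> that \<open>D\<close> attaches to \<open>q\<close> is the one that the conditional density divides by. The
  arguments of the logarithms differ, but their ratio does not.
\<close>

lemma D_eq_risk_barycenter:
  assumes "\<pi> \<in> priors \<Theta>" "compact \<Theta>" and nn: "\<And>i. 0 \<le> barycenter \<pi> $ i"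
  shows "D q \<pi> = risk (barycenter \<pi>) q"
  unfolding D_def risk_def mix_joint_barycenter mix_marginal_barycenter[OF assms(1,2)]
proof (intro sum.cong refl)
  fix x y
  let ?m = "barycenter \<pi>"
  show "log_ratio_term (?m $ (x, y)) (?m $ (x, y)) (q x y * marginal ?m x) =
      log_ratio_term (?m $ (x, y)) (cond_density ?m x y) (q x y)"
  proof (cases "?m $ (x, y) = 0")
    case False
    then have "0 < ?m $ (x, y)" "0 < marginal ?m x"
      using nn[of "(x, y)"] le_marginal[OF nn, of x y] by auto
    then show ?thesis
      by (auto simp: log_ratio_term_def elog_def cond_density_def ln_div ln_mult)
  qed (simp add: log_ratio_term_def flip: zero_ereal_def)
qed

text \<open>
  The prior is the image of a discrete distribution on the index type, so atoms may repeat and weights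
  may vanish. A fixed index type thus serves all priors of a sequence.
\<close>

lemma finite_prior:
  fixes a :: "'i::finite \<Rightarrow> real" and \<theta> :: "'i \<Rightarrow> real ^ ('x::finite \<times> 'y::finite)"
  assumes a: "\<And>i. 0 \<le> a i" "(\<Sum>i\<in>UNIV. a i) = 1" and \<theta>: "\<And>i. \<theta> i \<in> \<Theta>"
  obtains \<pi> where "\<pi> \<in> priors \<Theta>"
    "\<And>f :: _ \<Rightarrow> real. continuous_on \<Theta> f \<Longrightarrow> (\<integral>t. f t \<partial>\<pi>) = (\<Sum>i\<in>UNIV. a i * f (\<theta> i))"
proof
  define p where "p = embed_pmf a"
  have "(\<integral>\<^sup>+ i. ennreal (a i) \<partial>count_space UNIV) = 1"
    using a by (simp add: nn_integral_count_space_finite)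
  then have p: "pmf p i = a i" for i
    unfolding p_def using a by (intro pmf_embed_pmf) auto
  define \<pi> where "\<pi> = distr (measure_pmf p) (restrict_space borel \<Theta>) \<theta>"
  have meas: "\<theta> \<in> measurable (measure_pmf p) (restrict_space borel \<Theta>)"
    using \<theta> by (auto simp: measurable_def space_restrict_space)
  show "\<pi> \<in> priors \<Theta>"
    unfolding priors_def \<pi>_def using measure_pmf.prob_space_distr[OF meas] by simp
  show "(\<integral>t. f t \<partial>\<pi>) = (\<Sum>i\<in>UNIV. a i * f (\<theta> i))" if "continuous_on \<Theta> f"
    for f :: "_ \<Rightarrow> real"
    unfolding \<pi>_def
    by (subst integral_distr[OF meas borel_measurable_continuous_on_restrict[OF that]])
      (simp add: integral_measure_pmf[of UNIV] p)
qed

text \<open>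
  Caratheodory's theorem with a fixed number of points: \<open>'i option\<close> has one element more than the
  dimension of the space, and unused indices get weight \<open>0\<close>.
\<close>

lemma convex_hull_indexed:
  fixes \<Theta> :: "(real ^ 'i::finite) set"
  assumes "m \<in> convex hull \<Theta>"
  obtains a :: "'i option \<Rightarrow> real" and \<theta>
  where "\<And>j. 0 \<le> a j" "(\<Sum>j\<in>UNIV. a j) = 1" "\<And>j. \<theta> j \<in> \<Theta>" "m = (\<Sum>j\<in>UNIV. a j *\<^sub>R \<theta> j)"
proof -
  obtain S u where S: "finite S" "S \<subseteq> \<Theta>" "card S \<le> CARD('i) + 1"
      "\<forall>v\<in>S. 0 \<le> u v" "sum u S = 1" "(\<Sum>v\<in>S. u v *\<^sub>R v) = m"
    using assms unfolding convex_hull_caratheodory by auto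
  obtain v0 where v0: "v0 \<in> \<Theta>" using S by fastforce
  obtain g :: "_ \<Rightarrow> 'i option" where g: "inj_on g S"
    using card_le_inj[of S "UNIV :: 'i option set"] S(1,3) by auto
  define a where "a j = (if j \<in> g ` S then u (inv_into S g j) else 0)" for j
  define \<theta> where "\<theta> j = (if j \<in> g ` S then inv_into S g j else v0)" for j
  have sum: "(\<Sum>j\<in>UNIV. h j) = (\<Sum>v\<in>S. h (g v))" if "\<And>j. j \<notin> g ` S \<Longrightarrow> h j = 0"
    for h :: "_ \<Rightarrow> 'z::comm_monoid_add"
  proof -
    have "sum h UNIV = sum h (g ` S)"
      using that by (intro sum.mono_neutral_right) auto
    then show ?thesis by (simp add: sum.reindex[OF g])
  qed
  show ?thesis
  proof
    show "0 \<le> a j" for j using S(4) g by (auto simp: a_def)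
    show "(\<Sum>j\<in>UNIV. a j) = 1"
      by (subst sum) (use g S(5) in \<open>auto simp: a_def\<close>)
    show "\<theta> j \<in> \<Theta>" for j using S(2) v0 g by (auto simp: \<theta>_def)
    show "m = (\<Sum>j\<in>UNIV. a j *\<^sub>R \<theta> j)"
      by (subst sum) (use g S(6) in \<open>auto simp: a_def \<theta>_def\<close>)
  qed
qed

lemma barycenter_finite_prior:
  assumes "\<And>f :: _ \<Rightarrow> real. continuous_on \<Theta> f \<Longrightarrow> (\<integral>t. f t \<partial>\<pi>) = (\<Sum>j\<in>UNIV. a j * f (\<theta> j))"
  shows "barycenter \<pi> = (\<Sum>j\<in>UNIV. a j *\<^sub>R \<theta> j)"
proof -
  have "(\<integral>t. t $ i \<partial>\<pi>) = (\<Sum>j\<in>UNIV. a j * \<theta> j $ i)" for i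
    by (rule assms) (intro continuous_intros)
  then show ?thesis by (simp add: vec_eq_iff barycenter_def)
qed

lemma prior_with_barycenter:
  assumes "m \<in> convex hull \<Theta>"
  obtains \<pi> where "\<pi> \<in> priors \<Theta>" "barycenter \<pi> = m"
proof -
  obtain a :: "('a \<times> 'b) option \<Rightarrow> real" and \<theta> where a: "\<And>j. 0 \<le> a j" "(\<Sum>j\<in>UNIV. a j) = 1"
      "\<And>j. \<theta> j \<in> \<Theta>" "m = (\<Sum>j\<in>UNIV. a j *\<^sub>R \<theta> j)"
    using convex_hull_indexed[OF assms] by blast
  obtain \<pi> where "\<pi> \<in> priors \<Theta>"
    "\<And>f :: _ \<Rightarrow> real. continuous_on \<Theta> f \<Longrightarrow> (\<integral>t. f t \<partial>\<pi>) = (\<Sum>j\<in>UNIV. a j * f (\<theta> j))"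
    using finite_prior[of a \<theta> \<Theta>] a(1-3) by blast
  then show ?thesis using that barycenter_finite_prior a(4) by blast
qed

text \<open>
  This is the compactness of the set of priors, in the form needed for passing to subsequences. The
  given points are barycenters of priors on a fixed number of atoms; the vectors of
  weights and atoms lie in a bounded subset of a Euclidean space, and convergence of these vectors
  implies weak convergence of the priors.
\<close>

lemma convergent_priors_with_barycenters:
  assumes "compact \<Theta>" and m: "\<And>n. m n \<in> convex hull \<Theta>"
  obtains s \<pi>s where "strict_mono (s :: nat \<Rightarrow> nat)" "convergent_prior_seq \<Theta> \<pi>s"
    "\<And>n. barycenter (\<pi>s n) = m (s n)"
proof -
  have "\<exists>a :: ('a \<times> 'b) option \<Rightarrow> real. \<exists>\<theta>. (\<forall>j. 0 \<le> a j) \<and> (\<Sum>j\<in>UNIV. a j) = 1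
      \<and> (\<forall>j. \<theta> j \<in> \<Theta>) \<and> m n = (\<Sum>j\<in>UNIV. a j *\<^sub>R \<theta> j)" for n
    using convex_hull_indexed[OF m[of n]] by metis
  then have "\<forall>n. \<exists>a :: ('a \<times> 'b) option \<Rightarrow> real. \<exists>\<theta>. (\<forall>j. 0 \<le> a j) \<and> (\<Sum>j\<in>UNIV. a j) = 1
      \<and> (\<forall>j. \<theta> j \<in> \<Theta>) \<and> m n = (\<Sum>j\<in>UNIV. a j *\<^sub>R \<theta> j)"
    by blast
  from this[THEN choice] obtain a :: "nat \<Rightarrow> ('a \<times> 'b) option \<Rightarrow> real"
    where "\<forall>n. \<exists>\<theta>. (\<forall>j. 0 \<le> a n j) \<and> (\<Sum>j\<in>UNIV. a n j) = 1
      \<and> (\<forall>j. \<theta> j \<in> \<Theta>) \<and> m n = (\<Sum>j\<in>UNIV. a n j *\<^sub>R \<theta> j)"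
    by blast
  from this[THEN choice] obtain \<theta>
    where a: "\<And>n j. 0 \<le> a n j" "\<And>n. (\<Sum>j\<in>UNIV. a n j) = 1" "\<And>n j. \<theta> n j \<in> \<Theta>"
      "\<And>n. m n = (\<Sum>j\<in>UNIV. a n j *\<^sub>R \<theta> n j)"
    by blast
  define z where "z n = (\<chi> j. (a n j, \<theta> n j))" for n
  have a1: "a n j \<le> 1" for n j
    using member_le_sum[of j UNIV "a n"] a(1,2) by simp
  have K: "compact ({0..1} \<times> \<Theta> :: (real \<times> _) set)"
    using assms(1) by (intro compact_Times) auto
  have zK: "z n $ j \<in> {0..1} \<times> \<Theta>" for n j using a(1,3) a1 by (simp add: z_def)
  have "bounded (range z)"
  proof -
    obtain B where B: "\<And>v. v \<in> {0..1::real} \<times> \<Theta> \<Longrightarrow> norm v \<le> B"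
      using compact_imp_bounded[OF K] unfolding bounded_iff by blast
    have "norm (z n) \<le> (\<Sum>j\<in>(UNIV :: ('a \<times> 'b) option set). B)" for n
    proof -
      have "norm (z n) \<le> (\<Sum>j\<in>UNIV. norm (z n $ j))"
        unfolding norm_vec_def by (rule L2_set_le_sum) auto
      also have "\<dots> \<le> (\<Sum>j\<in>(UNIV :: ('a \<times> 'b) option set). B)" using zK B by (intro sum_mono) auto
      finally show ?thesis .
    qed
    then show ?thesis unfolding bounded_iff by blast
  qed
  then obtain z0 s where s: "strict_mono s" "(z \<circ> s) \<longlonglongrightarrow> z0"
    using bounded_imp_convergent_subsequence by blast
  have zj: "(\<lambda>n. z (s n) $ j) \<longlonglongrightarrow> z0 $ j" for j
    using tendsto_vec_nth[OF s(2), of j] by (simp add: o_def)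
  define a0 where "a0 j = fst (z0 $ j)" for j
  define \<theta>0 where "\<theta>0 j = snd (z0 $ j)" for j
  have a_lim: "(\<lambda>n. a (s n) j) \<longlonglongrightarrow> a0 j" for j
    using tendsto_fst[OF zj[of j]] by (simp add: z_def a0_def)
  have \<theta>_lim: "(\<lambda>n. \<theta> (s n) j) \<longlonglongrightarrow> \<theta>0 j" for j
    using tendsto_snd[OF zj[of j]] by (simp add: z_def \<theta>0_def)
  have a0: "0 \<le> a0 j" for j using a_lim a(1) by (meson LIMSEQ_le_const)
  have "(\<lambda>n. \<Sum>j\<in>UNIV. a (s n) j) \<longlonglongrightarrow> (\<Sum>j\<in>UNIV. a0 j)" by (intro tendsto_sum a_lim)
  then have a0s: "(\<Sum>j\<in>UNIV. a0 j) = 1" by (simp add: a(2) LIMSEQ_const_iff)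
  have \<theta>0: "\<theta>0 j \<in> \<Theta>" for j
    using closed_sequentially[OF compact_imp_closed[OF assms(1)] _ \<theta>_lim] a(3) by simp
  obtain \<pi>0 where \<pi>0: "\<pi>0 \<in> priors \<Theta>"
    "\<And>f :: _ \<Rightarrow> real. continuous_on \<Theta> f \<Longrightarrow> (\<integral>t. f t \<partial>\<pi>0) = (\<Sum>i\<in>UNIV. a0 i * f (\<theta>0 i))"
    using finite_prior[of a0 \<theta>0 \<Theta>] a0 a0s \<theta>0 by blast
  have "\<exists>\<pi>. \<pi> \<in> priors \<Theta> \<and> (\<forall>f :: _ \<Rightarrow> real. continuous_on \<Theta> f \<longrightarrow>
      (\<integral>t. f t \<partial>\<pi>) = (\<Sum>i\<in>UNIV. a (s n) i * f (\<theta> (s n) i)))" for n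
    using finite_prior[of "a (s n)" "\<theta> (s n)" \<Theta>] a(1-3) by metis
  then obtain \<pi>s where \<pi>s: "\<And>n. \<pi>s n \<in> priors \<Theta>"
    "\<And>n f. continuous_on \<Theta> f \<Longrightarrow>
      (\<integral>t. f t \<partial>\<pi>s n) = (\<Sum>i\<in>UNIV. a (s n) i * (f (\<theta> (s n) i) :: real))"
    by metis
  have "weakly_converges \<Theta> \<pi>s \<pi>0"
    unfolding weakly_converges_def
  proof (intro allI impI, elim conjE)
    fix f :: "_ \<Rightarrow> real" assume f: "continuous_on \<Theta> f"
    have "(\<lambda>n. f (\<theta> (s n) j)) \<longlonglongrightarrow> f (\<theta>0 j)" for j
      using continuous_on_tendsto_compose[OF f \<theta>_lim \<theta>0] a(3) by simp
    then show "(\<lambda>n. \<integral>t. f t \<partial>\<pi>s n) \<longlonglongrightarrow> (\<integral>t. f t \<partial>\<pi>0)"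
      unfolding \<pi>0(2)[OF f] \<pi>s(2)[OF f] by (intro tendsto_sum tendsto_mult a_lim)
  qed
  then have "convergent_prior_seq \<Theta> \<pi>s"
    unfolding convergent_prior_seq_def using \<pi>s(1) \<pi>0(1) by blast
  moreover have "barycenter (\<pi>s n) = m (s n)" for n
    using barycenter_finite_prior[OF \<pi>s(2)] a(4) by metis
  ultimately show ?thesis using that s(1) by blast
qed

section \<open>Dominating predictive densities\<close>

lemma convex_prob_simplex: "convex prob_simplex"
  unfolding convex_def prob_simplex_def
  by (auto simp: sum.distrib sum_distrib_left[symmetric])

lemma convex_hull_prob_simplex:
  "\<Theta> \<subseteq> prob_simplex \<Longrightarrow> convex hull \<Theta> \<subseteq> prob_simplex"
  by (intro hull_minimal convex_prob_simplex)

text \<open>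
  For every \<open>x\<close> some parameter gives mass to \<open>x\<close>; the uniform mixture of these parameters gives mass
  to all of them.
\<close>

lemma positive_mixture:
  fixes \<Theta> :: "(real ^ ('x::finite \<times> 'y::finite)) set"
  assumes "\<Theta> \<subseteq> prob_simplex" "\<forall>x. \<exists>\<theta>\<in>\<Theta>. marginal \<theta> x > 0"
  obtains \<mu> where "\<mu> \<in> convex hull \<Theta>" "\<And>x. 0 < marginal \<mu> x"
proof -
  obtain f where f: "\<And>x. f x \<in> \<Theta>" "\<And>x. 0 < marginal (f x) x"
    using assms(2) by metis
  define \<mu> where "\<mu> = (\<Sum>x\<in>(UNIV :: 'x set). (1 / real CARD('x)) *\<^sub>R f x)"
  show ?thesis
  proof
    show "\<mu> \<in> convex hull \<Theta>"
      unfolding \<mu>_def using f(1)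
      by (intro convex_sum convex_convex_hull) (auto intro: hull_inc)
    fix x
    have nn: "0 \<le> marginal (f x') x" for x'
      using f(1) assms(1) by (intro marginal_nonneg prob_simplex_nonneg) blast
    have "0 < (1 / real CARD('x)) * marginal (f x) x" using f(2) by simp
    also have "\<dots> \<le> (\<Sum>x'\<in>UNIV. (1 / real CARD('x)) * marginal (f x') x)"
      using member_le_sum[of x UNIV "\<lambda>x'. (1 / real CARD('x)) * marginal (f x') x"] nn by simp
    also have "\<dots> = marginal \<mu> x" by (simp add: \<mu>_def marginal_sum marginal_scaleR)
    finally show "0 < marginal \<mu> x" .
  qed
qed

text \<open>
  Mixing with the uniform density makes the entropy finite and keeps \<open>- ln q(y;x)\<close> at most \<open>ln (|Y| / s)\<close>.
\<close>

definition smooth :: "real \<Rightarrow> ('x::finite \<Rightarrow> 'y::finite \<Rightarrow> real) \<Rightarrow> 'x \<Rightarrow> 'y \<Rightarrow> real" where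
  "smooth s q x y = (1 - s) * q x y + s / CARD('y)"

lemma smooth_ge:
  fixes q :: "'x::finite \<Rightarrow> 'y::finite \<Rightarrow> real"
  assumes "predictive_density q" "s \<le> 1"
  shows "s / CARD('y) \<le> smooth s q x y"
  using assms by (simp add: smooth_def predictive_density_def)

lemma predictive_density_smooth:
  fixes q :: "'x::finite \<Rightarrow> 'y::finite \<Rightarrow> real"
  assumes q: "predictive_density q" and s: "0 < s" "s \<le> 1"
  shows "predictive_density (smooth s q)"
proof -
  have nn: "0 \<le> smooth s q x y" for x y
    using smooth_ge[OF q s(2), of x y] s(1) by (meson divide_nonneg_nonneg less_imp_le of_nat_0_le_iff order_trans)
  have sum: "(\<Sum>y\<in>UNIV. smooth s q x y) = 1" for x
  proof -
    have "(\<Sum>y\<in>UNIV. smooth s q x y) = (1 - s) * (\<Sum>y\<in>UNIV. q x y) + s"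
      by (simp add: smooth_def sum.distrib sum_distrib_left)
    then show ?thesis using q by (simp add: predictive_density_def)
  qed
  have "smooth s q x y \<le> 1" for x y
    using member_le_sum[of y UNIV "smooth s q x"] nn sum[of x] by simp
  with nn sum show ?thesis by (simp add: predictive_density_def)
qed

lemma log_lik_smooth_tendsto:
  assumes \<theta>: "\<And>i. 0 \<le> \<theta> $ i" and q: "\<And>x y. 0 < \<theta> $ (x, y) \<Longrightarrow> 0 < q x y" and s: "s \<longlonglongrightarrow> 0"
  shows "(\<lambda>n. log_lik \<theta> (smooth (s n) q)) \<longlonglongrightarrow> log_lik \<theta> q"
  unfolding log_lik_def
proof (intro tendsto_sum)
  fix x y
  show "(\<lambda>n. \<theta> $ (x, y) * ln (smooth (s n) q x y)) \<longlonglongrightarrow> \<theta> $ (x, y) * ln (q x y)"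
  proof (cases "\<theta> $ (x, y) = 0")
    case False
    then have "0 < q x y" using \<theta>[of "(x, y)"] q[of x y] by simp
    moreover have "(\<lambda>n. smooth (s n) q x y) \<longlonglongrightarrow> (1 - 0) * q x y + 0 / CARD('b)"
      unfolding smooth_def using s by (intro tendsto_intros) auto
    ultimately show ?thesis by (intro tendsto_intros) auto
  qed simp
qed

lemma log_lik_nonpos:
  assumes "\<And>i. 0 \<le> \<theta> $ i" "\<And>x y. 0 \<le> r x y" "\<And>x y. r x y \<le> 1"
  shows "log_lik \<theta> r \<le> 0"
proof -
  have "ln (r x y) \<le> 0" for x y
    using assms(2,3)[of x y] by (cases "r x y = 0") auto
  then show ?thesis
    unfolding log_lik_def by (intro sum_nonpos mult_nonneg_nonpos assms)
qed

lemma log_lik_ge_ln: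
  assumes \<theta>: "\<theta> \<in> prob_simplex" and "0 < b" "\<And>x y. b \<le> r x y"
  shows "ln b \<le> log_lik \<theta> r"
proof -
  have "(\<Sum>x\<in>UNIV. \<Sum>y\<in>UNIV. \<theta> $ (x, y)) = 1"
    using \<theta> sum_marginal[of \<theta>] by (simp add: prob_simplex_def marginal_def)
  then have "ln b = (\<Sum>x\<in>UNIV. \<Sum>y\<in>UNIV. \<theta> $ (x, y) * ln b)"
    by (simp flip: sum_distrib_right)
  also have "\<dots> \<le> log_lik \<theta> r"
    unfolding log_lik_def
  proof (intro sum_mono mult_left_mono prob_simplex_nonneg[OF \<theta>])
    fix x y
    show "ln b \<le> ln (r x y)" using assms(2) assms(3)[of x y] by simp
  qed
  finally show ?thesis .
qed

text \<open>
  Apply the domination by minimisers to the hull shrunk towards \<open>\<mu>\<close>, where all marginals are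
  positive, and to the smoothed density. The inequality obtained holds at
  \<open>s \<mu> + (1 - s) \<theta>\<close> instead of \<open>\<theta>\<close>. By affinity it splits into a part at \<open>\<theta>\<close> and a part at \<open>\<mu>\<close>; the
  latter is at most \<open>s * ln (|Y| / s)\<close>, since conditional densities are at most \<open>1\<close> and the smoothed density
  is at least \<open>s / |Y|\<close>.
\<close>

lemma approximate_dominator:
  fixes \<Theta> :: "(real ^ ('x::finite \<times> 'y::finite)) set"
  assumes \<Theta>: "\<Theta> \<subseteq> prob_simplex" "compact \<Theta>"
    and \<mu>: "\<mu> \<in> convex hull \<Theta>" "\<And>x. 0 < marginal \<mu> x"
    and q: "predictive_density q" and s: "0 < s" "s < 1"
  obtains m where "m \<in> convex hull \<Theta>" "\<And>x. 0 < marginal m x"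
    "\<And>\<theta>. \<theta> \<in> \<Theta> \<Longrightarrow> (\<forall>x y. 0 < \<theta> $ (x, y) \<longrightarrow> 0 < cond_density m x y) \<and>
      log_lik \<theta> (smooth s q) - s / (1 - s) * ln (CARD('y) / s) \<le> log_lik \<theta> (cond_density m)"
proof -
  let ?H = "convex hull \<Theta>" and ?q = "smooth s q"
  define mix where "mix c = s *\<^sub>R \<mu> + (1 - s) *\<^sub>R c" for c
  have nn: "0 \<le> c $ i" if "c \<in> ?H" for c i
    using that convex_hull_prob_simplex[OF \<Theta>(1)] prob_simplex_nonneg by blast
  have mix: "mix c \<in> ?H" if "c \<in> ?H" for c
    unfolding mix_def using convexD[OF convex_convex_hull \<mu>(1) that] s by simp
  have "continuous_on ?H mix" unfolding mix_def by (intro continuous_intros)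
  then have "continuous_on ?H (\<lambda>c. rel_entropy ?q (mix c))"
    by (rule continuous_on_compose2[OF continuous_on_rel_entropy]) (use mix nn in blast)
  then obtain c where c: "c \<in> ?H" "\<And>c'. c' \<in> ?H \<Longrightarrow> rel_entropy ?q (mix c) \<le> rel_entropy ?q (mix c')"
    using continuous_attains_inf[OF compact_convex_hull[OF \<Theta>(2)]] \<mu>(1) by blast
  define m where "m = mix c"
  have mH: "m \<in> ?H" unfolding m_def using mix c(1) by blast
  have "0 < s / CARD('y)" using s by simp
  then have q_pos: "0 < ?q x y" for x y
    using smooth_ge[OF q, of s x y] s by linarith
  have m_pos: "0 < marginal m x" for x
    using \<mu>(2)[of x] s marginal_nonneg[OF nn[OF c(1)], of x]
    by (simp add: m_def mix_def marginal_add marginal_scaleR add_pos_nonneg)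
  show ?thesis
  proof
    show "m \<in> ?H" by fact
    show "0 < marginal m x" for x by fact
    fix \<theta> assume "\<theta> \<in> \<Theta>"
    then have \<theta>: "\<theta> \<in> ?H" by (rule hull_inc)
    have "(\<forall>x y. 0 < mix \<theta> $ (x, y) \<longrightarrow> 0 < cond_density m x y) \<and>
        log_lik (mix \<theta>) ?q + rel_entropy ?q m \<le> log_lik (mix \<theta>) (cond_density m)"
    proof (rule minimiser_dominates)
      show "0 \<le> m $ i" "0 \<le> mix \<theta> $ i" for i using nn mH mix \<theta> by blast+
      show "0 < marginal m x" for x by fact
      fix t :: real assume t: "0 < t" "t < 1"
      have "(1 - t) *\<^sub>R m + t *\<^sub>R mix \<theta> = mix ((1 - t) *\<^sub>R c + t *\<^sub>R \<theta>)"
        by (simp add: m_def mix_def vec_eq_iff algebra_simps)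
      moreover have "(1 - t) *\<^sub>R c + t *\<^sub>R \<theta> \<in> ?H"
        using convexD[OF convex_convex_hull c(1) \<theta>] t by simp
      ultimately show "rel_entropy ?q m \<le> rel_entropy ?q ((1 - t) *\<^sub>R m + t *\<^sub>R mix \<theta>)"
        using c(2) by (simp add: m_def)
    qed
    then have dom: "\<And>x y. 0 < mix \<theta> $ (x, y) \<Longrightarrow> 0 < cond_density m x y"
      "log_lik (mix \<theta>) ?q + rel_entropy ?q m \<le> log_lik (mix \<theta>) (cond_density m)"
      by blast+
    have mix_lik: "log_lik (mix \<theta>) r = s * log_lik \<mu> r + (1 - s) * log_lik \<theta> r" for r
      by (simp add: mix_def log_lik_add log_lik_scaleR)
    have "0 \<le> rel_entropy ?q m"
      using s q_pos by (intro rel_entropy_nonneg nn[OF mH] predictive_density_smooth[OF q]) auto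
    with dom(2) have "log_lik (mix \<theta>) ?q \<le> log_lik (mix \<theta>) (cond_density m)" by linarith
    moreover have "log_lik \<mu> (cond_density m) \<le> 0"
      by (intro log_lik_nonpos nn[OF \<mu>(1)] cond_density_nonneg cond_density_le_1 nn[OF mH])
    then have "s * log_lik \<mu> (cond_density m) \<le> 0" using s by (simp add: mult_le_0_iff)
    moreover have "ln (s / CARD('y)) \<le> log_lik \<mu> ?q"
      using s \<mu>(1) convex_hull_prob_simplex[OF \<Theta>(1)] smooth_ge[OF q]
      by (intro log_lik_ge_ln) auto
    then have "- ln (CARD('y) / s) \<le> log_lik \<mu> ?q" using s by (simp add: ln_div)
    then have "s * (- ln (CARD('y) / s)) \<le> s * log_lik \<mu> ?q"
      using s by (intro mult_left_mono) auto
    ultimately have "(1 - s) * log_lik \<theta> ?q - s * ln (CARD('y) / s)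
        \<le> (1 - s) * log_lik \<theta> (cond_density m)"
      by (simp add: mix_lik)
    then have "log_lik \<theta> ?q - s / (1 - s) * ln (CARD('y) / s) \<le> log_lik \<theta> (cond_density m)"
      using s by (simp add: field_simps)
    moreover have "0 < cond_density m x y" if "0 < \<theta> $ (x, y)" for x y
      using that s nn[OF \<mu>(1), of "(x, y)"]
      by (intro dom(1)) (simp add: mix_def add_nonneg_pos)
    ultimately show "(\<forall>x y. 0 < \<theta> $ (x, y) \<longrightarrow> 0 < cond_density m x y) \<and>
      log_lik \<theta> ?q - s / (1 - s) * ln (CARD('y) / s) \<le> log_lik \<theta> (cond_density m)"
      by blast
  qed
qed

text \<open>
  The approximate dominators for \<open>s \<rightarrow> 0\<close> are thinned twice: first so that their conditional densities
  converge, then so that they are barycenters of a weakly convergent sequence of priors. The weak limit of the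
  priors does not determine the limit of the conditional densities, because marginals may vanish in the limit.
  At parameters where \<open>q\<close> has infinite risk there is nothing to prove; at the others the smoothing
  disappears in the limit.
\<close>

lemma limit_of_bayes_dominates:
  fixes \<Theta> :: "(real ^ ('x::finite \<times> 'y::finite)) set"
  assumes \<Theta>: "\<Theta> \<subseteq> prob_simplex" "compact \<Theta>" "\<forall>x. \<exists>\<theta>\<in>\<Theta>. marginal \<theta> x > 0"
    and q: "predictive_density q"
  shows "\<exists>\<pi>s. convergent_prior_seq \<Theta> \<pi>s \<and>
    (\<forall>n x. mix_marginal (\<pi>s n) x > 0) \<and>
    (\<forall>x y. convergent (\<lambda>n. bayes_pred (\<pi>s n) x y)) \<and>
    (\<forall>\<theta>\<in>\<Theta>. risk \<theta> (\<lambda>x y. lim (\<lambda>n. bayes_pred (\<pi>s n) x y)) \<le> risk \<theta> q)"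
proof -
  have H: "convex hull \<Theta> \<subseteq> prob_simplex" by (rule convex_hull_prob_simplex[OF \<Theta>(1)])
  obtain \<mu> where \<mu>: "\<mu> \<in> convex hull \<Theta>" "\<And>x. 0 < marginal \<mu> x"
    using positive_mixture[OF \<Theta>(1,3)] by blast
  define s where "s n = 1 / (real n + 2)" for n
  have s: "0 < s n" "s n < 1" for n by (auto simp: s_def)
  define err where "err n = s n / (1 - s n) * ln (CARD('y) / s n)" for n
  have "\<exists>m. m \<in> convex hull \<Theta> \<and> (\<forall>x. 0 < marginal m x) \<and>
    (\<forall>\<theta>\<in>\<Theta>. (\<forall>x y. 0 < \<theta> $ (x, y) \<longrightarrow> 0 < cond_density m x y) \<and>
      log_lik \<theta> (smooth (s n) q) - err n \<le> log_lik \<theta> (cond_density m))" for n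
    unfolding err_def using approximate_dominator[OF \<Theta>(1,2) \<mu> q s[of n]] by metis
  then obtain m where m: "\<And>n. m n \<in> convex hull \<Theta>" "\<And>n x. 0 < marginal (m n) x"
    "\<And>n \<theta> x y. \<theta> \<in> \<Theta> \<Longrightarrow> 0 < \<theta> $ (x, y) \<Longrightarrow> 0 < cond_density (m n) x y"
    "\<And>n \<theta>. \<theta> \<in> \<Theta> \<Longrightarrow> log_lik \<theta> (smooth (s n) q) - err n \<le> log_lik \<theta> (cond_density (m n))"
    by metis
  have nn: "0 \<le> m n $ i" for n i using m(1) H prob_simplex_nonneg by blast
  define r where "r n = (\<chi> i. cond_density (m n) (fst i) (snd i))" for n
  have "range r \<subseteq> cbox 0 1"
    using cond_density_nonneg[OF nn] cond_density_le_1[OF nn]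
    by (auto simp: r_def interval_cbox_cart mem_box_cart)
  then have "bounded (range r)" using bounded_cbox bounded_subset by blast
  then obtain r0 k1 where k1: "strict_mono k1" "(r \<circ> k1) \<longlonglongrightarrow> r0"
    using bounded_imp_convergent_subsequence by blast
  obtain k2 \<pi>s where k2: "strict_mono k2" "convergent_prior_seq \<Theta> \<pi>s"
    "\<And>n. barycenter (\<pi>s n) = (m \<circ> k1) (k2 n)"
    using convergent_priors_with_barycenters[OF \<Theta>(2), of "m \<circ> k1"] m(1) by auto
  define k where "k = k1 \<circ> k2"
  have k: "strict_mono k" unfolding k_def using k1(1) k2(1) by (rule strict_mono_o)
  have \<pi>s: "\<pi>s n \<in> priors \<Theta>" for n using k2(2) by (simp add: convergent_prior_seq_def)
  have bayes: "bayes_pred (\<pi>s n) = cond_density (m (k n))" for n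
    using bayes_pred_barycenter[OF \<pi>s \<Theta>(2)] k2(3) by (simp add: k_def)
  have lim: "(\<lambda>n. bayes_pred (\<pi>s n) x y) \<longlonglongrightarrow> r0 $ (x, y)" for x y
  proof -
    have "(\<lambda>n. (r \<circ> k1 \<circ> k2) n $ (x, y)) \<longlonglongrightarrow> r0 $ (x, y)"
      using LIMSEQ_subseq_LIMSEQ[OF k1(2) k2(1)] by (rule tendsto_vec_nth)
    then show ?thesis by (simp add: bayes r_def k_def)
  qed
  have lim_eq: "lim (\<lambda>n. bayes_pred (\<pi>s n) x y) = r0 $ (x, y)" for x y
    using lim by (rule limI)
  have r0_nonneg: "0 \<le> r0 $ (x, y)" for x y
    using lim[of x y] cond_density_nonneg[OF nn] by (intro LIMSEQ_le_const) (auto simp: bayes)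
  have "risk \<theta> (\<lambda>x y. r0 $ (x, y)) \<le> risk \<theta> q" if "\<theta> \<in> \<Theta>" for \<theta>
  proof (rule risk_mono)
    show \<theta>: "0 \<le> \<theta> $ i" for i using that \<Theta>(1) prob_simplex_nonneg by blast
    show "0 \<le> q x y" for x y using q by (simp add: predictive_density_def)
    assume q_pos: "\<And>x y. 0 < \<theta> $ (x, y) \<Longrightarrow> 0 < q x y"
    have "s \<longlonglongrightarrow> 0" unfolding s_def by real_asymp
    then have "(\<lambda>n. log_lik \<theta> (smooth (s n) q)) \<longlonglongrightarrow> log_lik \<theta> q"
      by (intro log_lik_smooth_tendsto \<theta> q_pos)
    moreover have "err \<longlonglongrightarrow> 0" unfolding err_def s_def by real_asymp
    ultimately have "(\<lambda>n. log_lik \<theta> (smooth (s n) q) - err n) \<longlonglongrightarrow> log_lik \<theta> q - 0"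
      by (rule tendsto_diff)
    then have "(\<lambda>n. log_lik \<theta> (smooth (s (k n)) q) - err (k n)) \<longlonglongrightarrow> log_lik \<theta> q - 0"
      using LIMSEQ_subseq_LIMSEQ[OF _ k] by (force simp: o_def)
    then have "(\<forall>x y. 0 < \<theta> $ (x, y) \<longrightarrow> 0 < r0 $ (x, y)) \<and>
        log_lik \<theta> q - 0 \<le> log_lik \<theta> (\<lambda>x y. r0 $ (x, y))"
      by (intro log_lik_limit[where r = "\<lambda>n. bayes_pred (\<pi>s n)"] \<theta> lim)
        (use m(3,4) that in \<open>auto simp: bayes\<close>)
    then show "(\<forall>x y. 0 < \<theta> $ (x, y) \<longrightarrow> 0 < r0 $ (x, y)) \<and>
        log_lik \<theta> q \<le> log_lik \<theta> (\<lambda>x y. r0 $ (x, y))"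
      by simp
  qed (rule r0_nonneg)
  moreover have "mix_marginal (\<pi>s n) x > 0" for n x
    using m(2) k2(3) by (simp add: mix_marginal_barycenter[OF \<pi>s \<Theta>(2)])
  moreover have "convergent (\<lambda>n. bayes_pred (\<pi>s n) x y)" for x y
    using lim by (rule convergentI)
  ultimately show ?thesis using k2(2) by (auto simp: lim_eq)
qed

text \<open>
  Every point of the convex hull is the barycenter of a prior, so the barycenter of \<open>\<pi>\<close> minimises the
  risk of \<open>q\<close> over the hull, in particular along segments towards \<open>\<theta>\<close>. If \<open>q\<close> has finite risk at
  \<open>\<theta>\<close>, minimality makes the risk at the barycenter finite, so real entropies can be compared.
\<close>

lemma minimiser_bayes_dominates:
  fixes \<Theta> :: "(real ^ ('x::finite \<times> 'y::finite)) set"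
  assumes \<Theta>: "\<Theta> \<subseteq> prob_simplex" "compact \<Theta>" and q: "predictive_density q"
    and \<pi>: "\<pi> \<in> priors \<Theta>" and min: "D q \<pi> = (INF \<pi>'\<in>priors \<Theta>. D q \<pi>')"
    and pos: "\<And>x. mix_marginal \<pi> x > 0" and "\<theta> \<in> \<Theta>"
  shows "risk \<theta> (bayes_pred \<pi>) \<le> risk \<theta> q"
proof -
  let ?H = "convex hull \<Theta>"
  define m where "m = barycenter \<pi>"
  have mH: "m \<in> ?H" unfolding m_def by (rule barycenter_in_convex_hull[OF \<pi> \<Theta>(2)])
  have \<theta>H: "\<theta> \<in> ?H" using \<open>\<theta> \<in> \<Theta>\<close> by (rule hull_inc)
  have nn: "0 \<le> c $ i" if "c \<in> ?H" for c i
    using that convex_hull_prob_simplex[OF \<Theta>(1)] prob_simplex_nonneg by blast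
  have q_nonneg: "0 \<le> q x y" for x y using q by (simp add: predictive_density_def)
  have risk_min: "risk m q \<le> risk c q" if "c \<in> ?H" for c
  proof -
    obtain \<pi>' where \<pi>': "\<pi>' \<in> priors \<Theta>" "barycenter \<pi>' = c"
      using prior_with_barycenter[OF \<open>c \<in> ?H\<close>] by blast
    have "D q \<pi> \<le> D q \<pi>'" unfolding min using \<pi>'(1) by (rule INF_lower)
    then show ?thesis
      using D_eq_risk_barycenter[OF \<pi> \<Theta>(2)] D_eq_risk_barycenter[OF \<pi>'(1) \<Theta>(2)] nn mH that \<pi>'(2)
      by (simp add: m_def)
  qed
  have "risk \<theta> (cond_density m) \<le> risk \<theta> q"
  proof (rule risk_mono)
    show "0 \<le> \<theta> $ i" "0 \<le> q x y" "0 \<le> cond_density m x y" for i x y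
      by (fact nn[OF \<theta>H] q_nonneg cond_density_nonneg[OF nn[OF mH]])+
    assume q\<theta>: "\<And>x y. 0 < \<theta> $ (x, y) \<Longrightarrow> 0 < q x y"
    have qm: "0 < q x y" if "0 < m $ (x, y)" for x y
      using risk_min[OF \<theta>H] q\<theta> that
      by (auto simp: risk_eq[OF nn[OF \<theta>H] q_nonneg] risk_eq[OF nn[OF mH] q_nonneg] split: if_splits)
    have "(\<forall>x y. 0 < \<theta> $ (x, y) \<longrightarrow> 0 < cond_density m x y) \<and>
        log_lik \<theta> q + rel_entropy q m \<le> log_lik \<theta> (cond_density m)"
    proof (rule minimiser_dominates[OF nn[OF mH] nn[OF \<theta>H]])
      show "0 < marginal m x" for x
        using pos mix_marginal_barycenter[OF \<pi> \<Theta>(2)] by (simp add: m_def)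
      fix t :: real assume t: "0 < t" "t < 1"
      let ?c = "(1 - t) *\<^sub>R m + t *\<^sub>R \<theta>"
      have c: "?c \<in> ?H" using convexD[OF convex_convex_hull mH \<theta>H] t by simp
      have "0 < q x y" if "0 < ?c $ (x, y)" for x y
      proof (rule ccontr)
        assume "\<not> 0 < q x y"
        then have "m $ (x, y) = 0" "\<theta> $ (x, y) = 0"
          using qm[of x y] q\<theta>[of x y] nn[OF mH, of "(x, y)"] nn[OF \<theta>H, of "(x, y)"]
          by (auto simp: order_le_less)
        with that show False by simp
      qed
      then show "rel_entropy q m \<le> rel_entropy q ?c"
        using risk_min[OF c] qm
        by (simp add: risk_eq[OF nn[OF c] q_nonneg] risk_eq[OF nn[OF mH] q_nonneg] rel_entropy_def)
    qed
    moreover have "0 \<le> rel_entropy q m" by (rule rel_entropy_nonneg[OF nn[OF mH] q qm])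
    ultimately show "(\<forall>x y. 0 < \<theta> $ (x, y) \<longrightarrow> 0 < cond_density m x y) \<and>
        log_lik \<theta> q \<le> log_lik \<theta> (cond_density m)"
      by auto
  qed
  then show ?thesis by (simp add: m_def bayes_pred_barycenter[OF \<pi> \<Theta>(2)])
qed

theorem theorem1:
  fixes \<Theta> :: "(real ^ ('x::finite \<times> 'y::finite)) set"
  assumes "\<Theta> \<subseteq> prob_simplex"
    and "compact \<Theta>"
    and "\<forall>x. \<exists>\<theta>\<in>\<Theta>. marginal \<theta> x > 0"
  shows "(\<forall>q. predictive_density q \<longrightarrow>
            (\<exists>\<pi>s. convergent_prior_seq \<Theta> \<pi>s \<and>
                  (\<forall>n x. mix_marginal (\<pi>s n) x > 0) \<and>
                  (\<forall>x y. convergent (\<lambda>n. bayes_pred (\<pi>s n) x y)) \<and>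
                  (\<forall>\<theta>\<in>\<Theta>. risk \<theta> (\<lambda>x y. lim (\<lambda>n. bayes_pred (\<pi>s n) x y)) \<le> risk \<theta> q)))
       \<and> (\<forall>q. predictive_density q \<longrightarrow>
            (\<forall>\<pi>\<in>priors \<Theta>. D q \<pi> = (INF \<pi>'\<in>priors \<Theta>. D q \<pi>') \<and>
                           (\<forall>x. mix_marginal \<pi> x > 0) \<longrightarrow>
               (\<forall>\<theta>\<in>\<Theta>. risk \<theta> (bayes_pred \<pi>) \<le> risk \<theta> q)))"
proof (intro conjI allI impI ballI; (elim conjE)?)
  fix q :: "'x \<Rightarrow> 'y \<Rightarrow> real" assume "predictive_density q"
  then show "\<exists>\<pi>s. convergent_prior_seq \<Theta> \<pi>s \<and>
    (\<forall>n x. mix_marginal (\<pi>s n) x > 0) \<and>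
    (\<forall>x y. convergent (\<lambda>n. bayes_pred (\<pi>s n) x y)) \<and>
    (\<forall>\<theta>\<in>\<Theta>. risk \<theta> (\<lambda>x y. lim (\<lambda>n. bayes_pred (\<pi>s n) x y)) \<le> risk \<theta> q)"
    by (rule limit_of_bayes_dominates[OF assms])
qed (rule minimiser_bayes_dominates[OF assms(1,2)]; blast)

end
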